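(* For $n\ge1$ let $b(n,j)$ (resp. $\bar b(n,j)$) be the number of signed permutations in $\mathcal{B}_n$ with $j$ descents at odd positions and no descents (resp. no ascents) at even positions, so that $B_n(x,0)=\sum_{j=0}^{\lfloor n/2\rfloor}b(n,j)x^j$ and $\widehat{B}_n(x,0)=\sum_{j=0}^{\lfloor n/2\rfloor}\bar b(n,j)x^j$. Then $$\widetilde{B}_n(x,y)=\sum_{j=0}^{\lfloor n/2\rfloor}b(n,j)(x+y)^j(1+xy)^{\lfloor n/2\rfloor-j},\qquad \overline{B}_n(x,y)=\sum_{j=0}^{\lfloor n/2\rfloor}\bar b(n,j)(x+y)^j(1+xy)^{\lfloor n/2\rfloor-j}.$$
   Context: $\mathcal{B}_n$ is the set of signed permutations of $\{\pm1,\dots,\pm n\}$ ($\sigma(-i)=-\sigma(i)$), each identified with the word $\sigma(0)\sigma(1)\cdots\sigma(n)$ with $\sigma(0)=0$. A position $i\in\{0,\dots,n-1\}$ is a descent if $\sigma(i)>\sigma(i+1)$ and an ascent if $\sigma(i)<\sigma(i+1)$; "even positions" include $0$. $\mathrm{des}_1\sigma$ (resp. $\mathrm{des}_0\sigma$) counts descents at odd (resp. even) positions; $\mathrm{asc}_0\sigma$ counts ascents at even positions. $B_n(x,y)=\sum_{\sigma\in\mathcal{B}_n}x^{\mathrm{des}_1\sigma}y^{\mathrm{des}_0\sigma}$, $\widehat{B}_n(x,y)=\sum_{\sigma\in\mathcal{B}_n}x^{\mathrm{des}_1\sigma}y^{\mathrm{asc}_0\sigma}$. For $m\ge1$: $\widetilde{B}_{2m}=B_{2m}$,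 $\widetilde{B}_{2m-1}=(1+y)^{-1}B_{2m-1}$, $\overline{B}_{2m}=\widehat{B}_{2m}$, $\overline{B}_{2m-1}=(1+y)^{-1}\widehat{B}_{2m-1}$. *)

theory Defs
  imports "HOL-Combinatorics.Permutations" "HOL-Computational_Algebra.Computational_Algebra"
begin

text \<open>
  Signed permutations are permutations of \<open>{\<plusminus>1, \<dots>, \<plusminus>n}\<close> extended by the identity to all integers;
  in particular \<open>\<sigma> 0 = 0\<close>, as in the convention for the word \<open>\<sigma>(0) \<sigma>(1) \<dots> \<sigma>(n)\<close>.
\<close>

definition signed_perms :: "nat \<Rightarrow> (int \<Rightarrow> int) set" where
  "signed_perms n = {\<sigma>. \<sigma> permutes ({- int n..int n} - {0}) \<and> (\<forall>i. \<sigma> (- i) = - \<sigma> i)}"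

definition descents :: "nat \<Rightarrow> (int \<Rightarrow> int) \<Rightarrow> nat set" where
  "descents n \<sigma> = {i \<in> {0..<n}. \<sigma> (int i) > \<sigma> (int (i + 1))}"

definition ascents :: "nat \<Rightarrow> (int \<Rightarrow> int) \<Rightarrow> nat set" where
  "ascents n \<sigma> = {i \<in> {0..<n}. \<sigma> (int i) < \<sigma> (int (i + 1))}"

definition des1 :: "nat \<Rightarrow> (int \<Rightarrow> int) \<Rightarrow> nat" where
  "des1 n \<sigma> = card {i \<in> descents n \<sigma>. odd i}"

definition des0 :: "nat \<Rightarrow> (int \<Rightarrow> int) \<Rightarrow> nat" where
  "des0 n \<sigma> = card {i \<in> descents n \<sigma>. even i}"

definition asc0 :: "nat \<Rightarrow> (int \<Rightarrow> int) \<Rightarrow> nat" where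
  "asc0 n \<sigma> = card {i \<in> ascents n \<sigma>. even i}"

text \<open>
  Bivariate polynomials are elements of \<open>\<int>[x][y]\<close>: \<open>y\<close> is the outer variable, so that setting
  \<open>y = 0\<close> in \<open>p\<close> is \<open>poly p 0\<close>, a polynomial in \<open>x\<close>.
\<close>

definition varX :: "int poly poly" where
  "varX = [:[:0, 1:]:]"

definition varY :: "int poly poly" where
  "varY = [:0, 1:]"

definition B_poly :: "nat \<Rightarrow> int poly poly" where
  "B_poly n = (\<Sum>\<sigma>\<in>signed_perms n. varX ^ des1 n \<sigma> * varY ^ des0 n \<sigma>)"

definition Bhat_poly :: "nat \<Rightarrow> int poly poly" where
  "Bhat_poly n = (\<Sum>\<sigma>\<in>signed_perms n. varX ^ des1 n \<sigma> * varY ^ asc0 n \<sigma>)"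

text \<open>
  The factor \<open>(1 + y)\<^sup>-\<^sup>1\<close> is taken in the field of fractions of \<open>\<int>[x][y]\<close>, so divisibility by
  \<open>1 + y\<close> is not built into the definitions. The value at \<open>n = 0\<close> is immaterial.
\<close>

definition Btilde :: "nat \<Rightarrow> int poly poly fract" where
  "Btilde n = (if even n then to_fract (B_poly n)
               else inverse (to_fract (1 + varY)) * to_fract (B_poly n))"

definition Bbar :: "nat \<Rightarrow> int poly poly fract" where
  "Bbar n = (if even n then to_fract (Bhat_poly n)
             else inverse (to_fract (1 + varY)) * to_fract (Bhat_poly n))"

definition b_num :: "nat \<Rightarrow> nat \<Rightarrow> nat" where
  "b_num n j = card {\<sigma> \<in> signed_perms n. des1 n \<sigma> = j \<and> des0 n \<sigma> = 0}"

definition bbar_num :: "nat \<Rightarrow> nat \<Rightarrow> nat" where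
  "bbar_num n j = card {\<sigma> \<in> signed_perms n. des1 n \<sigma> = j \<and> asc0 n \<sigma> = 0}"

end

theory Submission
  imports Defs
begin

text \<open>
  Give a descent the sign \<open>\<epsilon> = 1\<close> and an ascent the sign \<open>\<epsilon> = -1\<close>. Twice the weight of an odd
  position is \<open>(1 + x) + \<epsilon> (x - 1)\<close>, and similarly with \<open>y\<close> for an even position. Expanding the
  product over all positions, a set \<open>T\<close> of positions contributes the sum over all \<open>\<sigma>\<close> of the
  product of the signs at \<open>T\<close>. This sum vanishes when \<open>T\<close> has a maximal run of consecutive positions
  of odd length: reversing the letters of the run (or negating them if the run starts at position
  \<open>0\<close>) flips every sign in the run and changes no other sign of \<open>T\<close>. All other \<open>T\<close> contain as
  many odd as even positions. Because \<open>(1 + x)(1 + y)\<close> and \<open>(x - 1)(y - 1)\<close> are the sum and the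
  difference of \<open>1 + xy\<close> and \<open>x + y\<close>, the generating function is, up to powers of \<open>2\<close> and \<open>1 + y\<close>,
  a homogeneous form in \<open>1 + xy\<close> and \<open>x + y\<close>, and setting \<open>y = 0\<close> reads off its coefficients.
\<close>

section \<open>Signed permutations\<close>

lemma finite_signed_perms: "finite (signed_perms n)"
  by (rule finite_subset[OF _ finite_permutations[of "{- int n..int n} - {0}"]])
    (auto simp: signed_perms_def)

lemma signed_perms_compose:
  assumes "\<sigma> \<in> signed_perms n" "\<tau> \<in> signed_perms n"
  shows "\<sigma> \<circ> \<tau> \<in> signed_perms n"
  using assms by (auto simp: signed_perms_def intro: permutes_compose)

lemma signed_perms_inj: "\<sigma> \<in> signed_perms n \<Longrightarrow> inj \<sigma>"
  by (auto simp: signed_perms_def permutes_inj)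

lemma signed_perms_minus: "\<sigma> \<in> signed_perms n \<Longrightarrow> \<sigma> (- i) = - \<sigma> i"
  by (simp add: signed_perms_def)

lemma signed_permsI_involution:
  assumes "\<And>p. \<tau> (\<tau> p) = p" "\<And>p. \<tau> (- p) = - \<tau> p" "\<And>p. p = 0 \<or> int n < \<bar>p\<bar> \<Longrightarrow> \<tau> p = p"
  shows "\<tau> \<in> signed_perms n"
proof -
  have "\<tau> p = p" if "p \<notin> {- int n..int n} - {0}" for p
    using that by (intro assms(3)) auto
  moreover have "\<exists>!p. \<tau> p = q" for q
    using assms(1) by metis
  ultimately show ?thesis
    using assms(2) by (simp add: signed_perms_def permutes_def)
qed

section \<open>Sign-reversing involutions for runs of odd length\<close>

definition step_sign :: "(int \<Rightarrow> int) \<Rightarrow> nat \<Rightarrow> int" where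
  "step_sign \<sigma> i = (if \<sigma> (int i) > \<sigma> (int (i + 1)) then 1 else -1)"

text \<open>Composition with \<open>\<tau>\<close> on the right acts on positions and is an
  involution of \<open>signed_perms n\<close>, so reindexing by it shows that the integer sum equals
  its own negative.\<close>

lemma sum_signs_eq_0:
  assumes "\<tau> \<in> signed_perms n" "\<And>p. \<tau> (\<tau> p) = p"
    and flip: "\<And>\<sigma>. \<sigma> \<in> signed_perms n \<Longrightarrow>
      (\<Prod>k\<in>T. step_sign (\<sigma> \<circ> \<tau>) k) = - (\<Prod>k\<in>T. step_sign \<sigma> k)"
  shows "(\<Sum>\<sigma>\<in>signed_perms n. \<Prod>k\<in>T. step_sign \<sigma> k) = 0"
proof -
  have "\<tau> \<circ> \<tau> = id"
    using assms(2) by auto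
  then have "(\<Sum>\<sigma>\<in>signed_perms n. \<Prod>k\<in>T. step_sign \<sigma> k) =
    (\<Sum>\<sigma>\<in>signed_perms n. \<Prod>k\<in>T. step_sign (\<sigma> \<circ> \<tau>) k)"
    using signed_perms_compose[OF _ assms(1)]
    by (intro sum.reindex_bij_witness[of _ "\<lambda>\<sigma>. \<sigma> \<circ> \<tau>" "\<lambda>\<sigma>. \<sigma> \<circ> \<tau>"])
      (auto simp: comp_assoc)
  also have "\<dots> = - (\<Sum>\<sigma>\<in>signed_perms n. \<Prod>k\<in>T. step_sign \<sigma> k)"
    by (simp add: flip sum_negf)
  finally show ?thesis
    by simp
qed

text \<open>Only the product over the run is compared, not its individual signs, because a reversal
  flips the signs of a run and also permutes them.\<close>

lemma prod_signs_flip_run: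
  assumes "finite T" "{i..<i + r} \<subseteq> T" "odd r"
    and run: "(\<Prod>k\<in>{i..<i + r}. step_sign \<sigma>' k) = (-1) ^ r * (\<Prod>k\<in>{i..<i + r}. step_sign \<sigma> k)"
    and rest: "\<And>k. k \<in> T - {i..<i + r} \<Longrightarrow> step_sign \<sigma>' k = step_sign \<sigma> k"
  shows "(\<Prod>k\<in>T. step_sign \<sigma>' k) = - (\<Prod>k\<in>T. step_sign \<sigma> k)"
  using run rest \<open>odd r\<close>
  by (simp add: prod.subset_diff[OF assms(2,1)])

text \<open>Negating the letters at positions up to \<open>r\<close> reverses every comparison
  between them. The letter 0 at position 0 is unaffected, so step 0 flips too. The only other step
  that may change is \<open>r\<close>, which lies outside \<open>T\<close>.\<close>

lemma sum_signs_eq_0_initial_run: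
  assumes "T \<subseteq> {..<n}" "{0..<r} \<subseteq> T" "r \<notin> T" "odd r"
  shows "(\<Sum>\<sigma>\<in>signed_perms n. \<Prod>k\<in>T. step_sign \<sigma> k) = 0"
proof -
  define \<tau> :: "int \<Rightarrow> int" where "\<tau> p = (if \<bar>p\<bar> \<le> int r then - p else p)" for p
  \<comment> \<open>As \<open>r\<close> is odd it is positive, so the run has a last element; this
    keeps \<open>\<tau>\<close> within positions up to \<open>n\<close>.\<close>
  have "r - 1 \<in> T"
    using assms(2) \<open>odd r\<close> by (auto elim!: oddE)
  then have "r \<le> n"
    using assms(1) by auto
  show ?thesis
  proof (rule sum_signs_eq_0[of \<tau>])
    show "\<tau> \<in> signed_perms n"
      using \<open>r \<le> n\<close> by (intro signed_permsI_involution) (auto simp: \<tau>_def)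
    show "\<tau> (\<tau> p) = p" for p
      by (simp add: \<tau>_def)
    fix \<sigma> assume \<sigma>: "\<sigma> \<in> signed_perms n"
    have flip: "step_sign (\<sigma> \<circ> \<tau>) k = - step_sign \<sigma> k" if "k < r" for k
    proof -
      \<comment> \<open>Equal letters would give the default sign -1 on both sides; injectivity
        excludes them.\<close>
      have "\<sigma> (int k) \<noteq> \<sigma> (int (k + 1))"
        using injD[OF signed_perms_inj[OF \<sigma>], of "int k" "int (k + 1)"] by auto
      moreover have \<tau>: "\<tau> (int k) = - int k" "\<tau> (int (k + 1)) = - int (k + 1)"
        using that by (auto simp: \<tau>_def)
      ultimately show ?thesis
        unfolding step_sign_def comp_def \<tau> signed_perms_minus[OF \<sigma>] by simp
    qed
    have same: "step_sign (\<sigma> \<circ> \<tau>) k = step_sign \<sigma> k" if "k \<in> T - {0..<0 + r}" for k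
    proof -
      have "k > r"
        using that assms(3) by (cases "k = r") auto
      then show ?thesis
        by (simp add: step_sign_def \<tau>_def)
    qed
    have "(\<Prod>k\<in>{0..<r}. step_sign (\<sigma> \<circ> \<tau>) k) = (\<Prod>k\<in>{0..<r}. (-1) * step_sign \<sigma> k)"
      using flip by (intro prod.cong) auto
    also have "\<dots> = (-1) ^ r * (\<Prod>k\<in>{0..<r}. step_sign \<sigma> k)"
      unfolding prod.distrib by simp
    finally show "(\<Prod>k\<in>T. step_sign (\<sigma> \<circ> \<tau>) k) = - (\<Prod>k\<in>T. step_sign \<sigma> k)"
      using assms(2,4) finite_subset[OF assms(1) finite_lessThan] same
      by (intro prod_signs_flip_run[of T 0 r]) (simp_all only: add_0 not_False_eq_True)
  qed
qed

text \<open>Reversing the letters at positions \<open>i\<close> to \<open>i + r\<close> reflects the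
  run and flips all its signs. Beyond the run only steps \<open>i - 1\<close> and
  \<open>i + r\<close> may change, and neither belongs to \<open>T\<close>.\<close>

lemma sum_signs_eq_0_inner_run:
  assumes "T \<subseteq> {..<n}" "{i..<i + r} \<subseteq> T" "i + r \<notin> T" "i > 0" "i - 1 \<notin> T" "odd r"
  shows "(\<Sum>\<sigma>\<in>signed_perms n. \<Prod>k\<in>T. step_sign \<sigma> k) = 0"
proof -
  \<comment> \<open>The second branch is the odd extension to negative positions; since
    \<open>i > 0\<close>, the two intervals are disjoint and 0 stays fixed.\<close>
  define \<tau> :: "int \<Rightarrow> int" where
    "\<tau> p = (if int i \<le> p \<and> p \<le> int (i + r) then int (2 * i + r) - p
            else if int i \<le> - p \<and> - p \<le> int (i + r) then - int (2 * i + r) - p else p)" for p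
  have "i + r - 1 \<in> T"
    using assms(2) \<open>odd r\<close> by (auto elim!: oddE)
  then have "i + r \<le> n"
    using assms(1) by auto
  have \<tau>_run: "\<tau> (int k) = int (2 * i + r - k)" if "i \<le> k" "k \<le> i + r" for k
    using that by (auto simp: \<tau>_def)
  have invol: "\<tau> (\<tau> p) = p" for p
    using \<open>i > 0\<close> by (auto simp: \<tau>_def)
  show ?thesis
  proof (rule sum_signs_eq_0[of \<tau>])
    show "\<tau> \<in> signed_perms n"
    proof (rule signed_permsI_involution)
      show "\<tau> (- p) = - \<tau> p" for p
        using \<open>i > 0\<close> by (auto simp: \<tau>_def)
      show "\<tau> p = p" if "p = 0 \<or> int n < \<bar>p\<bar>" for p
        using that \<open>i > 0\<close> \<open>i + r \<le> n\<close> by (auto simp: \<tau>_def)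
    qed (rule invol)
    show "\<tau> (\<tau> p) = p" for p
      by (rule invol)
    fix \<sigma> assume \<sigma>: "\<sigma> \<in> signed_perms n"
    \<comment> \<open>Positions reflect by \<open>2 * i + r - k\<close>; a step is indexed by its
      left end, which becomes a right end, hence the shift by 1.\<close>
    have flip: "step_sign (\<sigma> \<circ> \<tau>) k = - step_sign \<sigma> (2 * i + r - 1 - k)"
      if "k \<in> {i..<i + r}" for k
    proof -
      define l where "l = 2 * i + r - 1 - k"
      have "\<tau> (int k) = int (l + 1)" "\<tau> (int (k + 1)) = int l"
        using that \<tau>_run[of k] \<tau>_run[of "k + 1"] by (auto simp: l_def)
      moreover have "\<sigma> (int l) \<noteq> \<sigma> (int (l + 1))"
        using injD[OF signed_perms_inj[OF \<sigma>], of "int l" "int (l + 1)"] by auto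
      ultimately show ?thesis
        unfolding step_sign_def comp_def l_def[symmetric] by simp
    qed
    have same: "step_sign (\<sigma> \<circ> \<tau>) k = step_sign \<sigma> k" if "k \<in> T - {i..<i + r}" for k
    proof -
      have "k \<noteq> i + r" "k \<noteq> i - 1"
        using that assms(3,5) by auto
      then have "k > i + r \<or> k + 1 < i"
        using that by auto
      then have "\<tau> (int k) = int k" "\<tau> (int (k + 1)) = int (k + 1)"
        using \<open>i > 0\<close> by (auto simp: \<tau>_def)
      then show ?thesis
        by (simp add: step_sign_def)
    qed
    have "(\<Prod>k\<in>{i..<i + r}. step_sign (\<sigma> \<circ> \<tau>) k) =
      (\<Prod>k\<in>{i..<i + r}. (-1) * step_sign \<sigma> (2 * i + r - 1 - k))"
      using flip by (intro prod.cong) auto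
    also have "\<dots> = (-1) ^ r * (\<Prod>k\<in>{i..<i + r}. step_sign \<sigma> (2 * i + r - 1 - k))"
      unfolding prod.distrib by simp
    also have "(\<Prod>k\<in>{i..<i + r}. step_sign \<sigma> (2 * i + r - 1 - k)) =
      (\<Prod>k\<in>{i..<i + r}. step_sign \<sigma> k)"
      by (rule prod.reindex_bij_witness[of _ "\<lambda>k. 2 * i + r - 1 - k" "\<lambda>k. 2 * i + r - 1 - k"]) auto
    finally show "(\<Prod>k\<in>T. step_sign (\<sigma> \<circ> \<tau>) k) = - (\<Prod>k\<in>T. step_sign \<sigma> k)"
      using assms(2,6) finite_subset[OF assms(1) finite_lessThan] same
      by (intro prod_signs_flip_run[of T i r]) (simp_all only: not_False_eq_True)
  qed
qed

section \<open>Odd runs in sets with unequal parity counts\<close>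

lemma card_parity_interval:
  "card {k \<in> {i..<i + 2 * s}. odd k} = s" "card {k \<in> {i..<i + 2 * s}. even k} = s" for i s :: nat
proof (induction s)
  case (Suc s)
  have *: "{k \<in> {i..<i + 2 * Suc s}. odd k} =
      insert (if odd i then i + 2 * s else i + 2 * s + 1) {k \<in> {i..<i + 2 * s}. odd k}"
    "{k \<in> {i..<i + 2 * Suc s}. even k} =
      insert (if even i then i + 2 * s else i + 2 * s + 1) {k \<in> {i..<i + 2 * s}. even k}"
    by (auto simp: less_Suc_eq)
  { case 1 show ?case unfolding *(1) using Suc.IH by (subst card_insert_disjoint) auto }
  { case 2 show ?case unfolding *(2) using Suc.IH by (subst card_insert_disjoint) auto }
qed auto

text \<open>A run of even length has equally many odd and even elements. If the first maximal run
  has even length, deleting it leaves a smaller set that is still unbalanced, and induction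
  applies.\<close>

lemma unbalanced_odd_run:
  fixes T :: "nat set"
  assumes "finite T" "card {k \<in> T. odd k} \<noteq> card {k \<in> T. even k}"
  shows "\<exists>i r. odd r \<and> {i..<i + r} \<subseteq> T \<and> i + r \<notin> T \<and> (i = 0 \<or> i - 1 \<notin> T)"
  using assms
proof (induction "card T" arbitrary: T rule: less_induct)
  case less
  then have "T \<noteq> {}"
    by auto
  define i where "i = Min T"
  have i: "i \<in> T" "\<And>k. k \<in> T \<Longrightarrow> i \<le> k"
    using \<open>finite T\<close> \<open>T \<noteq> {}\<close> by (auto simp: i_def)
  \<comment> \<open>The length of the maximal run starting at \<open>Min T\<close>. The least
    element exists because \<open>Suc (Max T)\<close> is not in \<open>T\<close>.\<close>
  define r where "r = (LEAST r. i + r \<notin> T)"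
  have "i + (Suc (Max T) - i) \<notin> T"
    using Max_ge[OF \<open>finite T\<close>, of "Suc (Max T)"] Max_ge[OF \<open>finite T\<close> i(1)] by auto
  then have r: "i + r \<notin> T"
    unfolding r_def by (rule LeastI)
  have sub: "{i..<i + r} \<subseteq> T"
  proof
    fix k assume "k \<in> {i..<i + r}"
    then have "k - i < r" "k = i + (k - i)"
      by auto
    then show "k \<in> T"
      using not_less_Least[of "k - i" "\<lambda>r. i + r \<notin> T"] unfolding r_def by auto
  qed
  show ?case
  proof (cases "odd r")
    case True
    have "i = 0 \<or> i - 1 \<notin> T"
      using i(2)[of "i - 1"] by auto
    then show ?thesis
      using True r sub by blast
  next
    case False
    then obtain s where s: "r = 2 * s"
      by (auto elim: evenE)
    define U where "U = T - {i..<i + r}"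
    have card_split: "card {k \<in> T. P k} = card {k \<in> {i..<i + r}. P k} + card {k \<in> U. P k}" for P
    proof -
      have "{k \<in> T. P k} = {k \<in> {i..<i + r}. P k} \<union> {k \<in> U. P k}"
        using sub by (auto simp: U_def)
      moreover have "{k \<in> {i..<i + r}. P k} \<inter> {k \<in> U. P k} = {}"
        by (auto simp: U_def)
      ultimately show ?thesis
        using \<open>finite T\<close> by (simp only:) (rule card_Un_disjoint, auto simp: U_def)
    qed
    have "r \<noteq> 0"
      using r i(1) by (metis add_0_right)
    then have "i \<notin> U"
      by (simp add: U_def)
    then have "U \<subset> T"
      using i(1) unfolding U_def by blast
    then have "card U < card T"
      using \<open>finite T\<close> by (intro psubset_card_mono)
    moreover have "card {k \<in> U. odd k} \<noteq> card {k \<in> U. even k}"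
      using less.prems(2) card_split[of odd] card_split[of even] card_parity_interval[of i s]
      unfolding s by simp
    ultimately obtain i' r' where *: "odd r'" "{i'..<i' + r'} \<subseteq> U" "i' + r' \<notin> U" "i' = 0 \<or> i' - 1 \<notin> U"
      using less.hyps[of U] \<open>finite T\<close> by (auto simp: U_def)
    have "i' \<in> U"
      using *(1,2) by (auto elim!: oddE)
    \<comment> \<open>The gap at \<open>i + r\<close> separates the two runs, so deleting the first
      one creates no new boundary at \<open>i' - 1\<close> or \<open>i' + r'\<close>: a maximal run
      of \<open>U\<close> is maximal in \<open>T\<close>.\<close>
    then have "i' > i + r"
      using i(2)[of i'] r by (cases "i' = i + r") (auto simp: U_def)
    then have "i' + r' \<notin> T" "i' - 1 \<notin> T" "{i'..<i' + r'} \<subseteq> T"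
      using * by (auto simp: U_def)
    then show ?thesis
      using *(1) by blast
  qed
qed

lemma sum_signs_eq_0_unbalanced:
  assumes "T \<subseteq> {..<n}" "card {k \<in> T. odd k} \<noteq> card {k \<in> T. even k}"
  shows "(\<Sum>\<sigma>\<in>signed_perms n. \<Prod>k\<in>T. step_sign \<sigma> k) = 0"
proof -
  have "finite T"
    using assms(1) finite_subset by blast
  then obtain i r where *: "odd r" "{i..<i + r} \<subseteq> T" "i + r \<notin> T" "i = 0 \<or> i - 1 \<notin> T"
    using unbalanced_odd_run assms(2) by blast
  show ?thesis
  proof (cases "i = 0")
    case True
    then show ?thesis
      using * assms(1) by (intro sum_signs_eq_0_initial_run[of T n r]) auto
  next
    case False
    then show ?thesis
      using * assms(1) by (intro sum_signs_eq_0_inner_run[of T n i r]) auto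
  qed
qed

section \<open>Homogeneous forms\<close>

text \<open>The coefficients are integers rather than elements of the ring, so they survive setting
  \<open>y = 0\<close> unchanged and can be read off there.\<close>

definition homogeneous_form :: "'a \<Rightarrow> 'a \<Rightarrow> nat \<Rightarrow> 'a :: comm_ring_1 \<Rightarrow> bool" where
  "homogeneous_form P Q m z \<longleftrightarrow> (\<exists>c :: nat \<Rightarrow> int. z = (\<Sum>j\<le>m. of_int (c j) * Q ^ j * P ^ (m - j)))"

lemma homogeneous_form_one: "homogeneous_form P Q 0 1"
  unfolding homogeneous_form_def by (rule exI[of _ "\<lambda>_. 1"]) simp

lemma homogeneous_form_zero: "homogeneous_form P Q m 0"
  unfolding homogeneous_form_def by (rule exI[of _ "\<lambda>_. 0"]) simp

lemma homogeneous_form_add: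
  assumes "homogeneous_form P Q m z" "homogeneous_form P Q m w"
  shows "homogeneous_form P Q m (z + w)"
proof -
  from assms obtain c d :: "nat \<Rightarrow> int" where
    "z = (\<Sum>j\<le>m. of_int (c j) * Q ^ j * P ^ (m - j))"
    "w = (\<Sum>j\<le>m. of_int (d j) * Q ^ j * P ^ (m - j))"
    by (auto simp: homogeneous_form_def)
  then show ?thesis
    unfolding homogeneous_form_def
    by (intro exI[of _ "\<lambda>j. c j + d j"]) (simp add: sum.distrib algebra_simps)
qed

lemma homogeneous_form_of_int_mult:
  assumes "homogeneous_form P Q m z"
  shows "homogeneous_form P Q m (of_int a * z)"
proof -
  from assms obtain c :: "nat \<Rightarrow> int" where "z = (\<Sum>j\<le>m. of_int (c j) * Q ^ j * P ^ (m - j))"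
    by (auto simp: homogeneous_form_def)
  then show ?thesis
    unfolding homogeneous_form_def
    by (intro exI[of _ "\<lambda>j. a * c j"]) (simp add: sum_distrib_left mult.assoc)
qed

lemma homogeneous_form_sum:
  "(\<And>t. t \<in> A \<Longrightarrow> homogeneous_form P Q m (f t)) \<Longrightarrow> homogeneous_form P Q m (sum f A)"
  by (induction A rule: infinite_finite_induct)
    (auto intro: homogeneous_form_add homogeneous_form_zero)

lemma homogeneous_form_mult_left:
  assumes "homogeneous_form P Q m z"
  shows "homogeneous_form P Q (Suc m) (P * z)"
proof -
  from assms obtain c :: "nat \<Rightarrow> int" where z: "z = (\<Sum>j\<le>m. of_int (c j) * Q ^ j * P ^ (m - j))"
    by (auto simp: homogeneous_form_def)
  have "P * z = (\<Sum>j\<le>m. of_int (c j) * Q ^ j * P ^ (Suc m - j))"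
    unfolding z sum_distrib_left by (intro sum.cong) (auto simp: Suc_diff_le)
  then show ?thesis
    \<comment> \<open>The index \<open>Suc m\<close> is new and needs coefficient 0, while
      \<open>c (Suc m)\<close> is arbitrary.\<close>
    unfolding homogeneous_form_def by (intro exI[of _ "\<lambda>j. if j \<le> m then c j else 0"]) simp
qed

lemma homogeneous_form_mult_right:
  assumes "homogeneous_form P Q m z"
  shows "homogeneous_form P Q (Suc m) (Q * z)"
proof -
  from assms obtain c :: "nat \<Rightarrow> int" where z: "z = (\<Sum>j\<le>m. of_int (c j) * Q ^ j * P ^ (m - j))"
    by (auto simp: homogeneous_form_def)
  show ?thesis
    unfolding homogeneous_form_def z
    \<comment> \<open>Multiplication by \<open>Q\<close> shifts the coefficients up by one
      index.\<close>
    by (intro exI[of _ "\<lambda>j. case j of 0 \<Rightarrow> 0 | Suc i \<Rightarrow> c i"])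
      (simp add: sum.atMost_Suc_shift sum_distrib_left mult_ac del: sum.atMost_Suc)
qed

lemma homogeneous_form_linear_mult:
  assumes "homogeneous_form P Q m z"
  shows "homogeneous_form P Q (Suc m) ((of_int a * P + of_int b * Q) * z)"
  using homogeneous_form_add[OF
    homogeneous_form_of_int_mult[OF homogeneous_form_mult_left[OF assms]]
    homogeneous_form_of_int_mult[OF homogeneous_form_mult_right[OF assms]]]
  by (simp add: algebra_simps)

lemma homogeneous_form_linear_power_mult:
  assumes "homogeneous_form P Q m z"
  shows "homogeneous_form P Q (k + m) ((of_int a * P + of_int b * Q) ^ k * z)"
proof (induction k)
  case (Suc k)
  then show ?case
    using homogeneous_form_linear_mult[OF Suc.IH] by (simp only: power_Suc mult.assoc add_Suc)
qed (simp add: assms)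

section \<open>The expansion\<close>

lemma prod_parity:
  fixes A :: "nat set"
  assumes "finite A"
  shows "(\<Prod>i\<in>A. if odd i then a else b) =
    a ^ card {i \<in> A. odd i} * (b :: 'a :: comm_monoid_mult) ^ card {i \<in> A. even i}"
  using assms by (simp add: prod.If_cases Int_def)

text \<open>Position 0 is even, so for odd \<open>n\<close> there is one surplus even position; it
  is the source of the factor \<open>1 + varY\<close>.\<close>

lemma card_parity_lessThan:
  "card {i \<in> {..<n}. odd i} = n div 2" "card {i \<in> {..<n}. even i} = n div 2 + n mod 2" for n :: nat
proof (induction n)
  case (Suc n)
  have *: "{i \<in> {..<Suc n}. P i} = (if P n then insert n {i \<in> {..<n}. P i} else {i \<in> {..<n}. P i})" for P
    by (auto simp: less_Suc_eq)
  { case 1 show ?case unfolding * using Suc.IH by (cases "even n") (auto elim!: evenE oddE) }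
  { case 2 show ?case unfolding * using Suc.IH by (cases "even n") (auto elim!: evenE oddE) }
qed auto

text \<open>In the expanded product, a set \<open>T\<close> with \<open>k\<close> odd and
  \<open>k\<close> even positions contributes \<open>k\<close> pairs \<open>q0 * q1\<close> and
  \<open>n div 2 - k\<close> pairs \<open>p0 * p1\<close>, each linear in \<open>P\<close> and
  \<open>Q\<close>, and one unpaired \<open>p0\<close> when \<open>n\<close> is odd. Unbalanced sets
  contribute nothing.\<close>

lemma sum_prod_signs_homogeneous:
  fixes p0 q0 p1 q1 P Q :: "'a :: comm_ring_1"
  assumes p: "p0 * p1 = of_int a * P + of_int b * Q" and q: "q0 * q1 = of_int c * P + of_int d * Q"
  shows "\<exists>z. homogeneous_form P Q (n div 2) z \<and>
    (\<Sum>\<sigma>\<in>signed_perms n. \<Prod>i<n. of_int (step_sign \<sigma> i) * (if odd i then q1 else q0) +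
      (if odd i then p1 else p0)) = p0 ^ (n mod 2) * z"
proof -
  define E where "E T = (\<Sum>\<sigma>\<in>signed_perms n. \<Prod>k\<in>T. step_sign \<sigma> k)" for T
  define w where "w T = (\<Prod>i\<in>T. if odd i then q1 else q0) * (\<Prod>i\<in>{..<n} - T. if odd i then p1 else p0)" for T
  have summand: "\<exists>z. homogeneous_form P Q (n div 2) z \<and> of_int (E T) * w T = p0 ^ (n mod 2) * z"
    if T: "T \<in> Pow {..<n}" for T
  proof (cases "card {k \<in> T. odd k} = card {k \<in> T. even k}")
    case False
    then show ?thesis
      using sum_signs_eq_0_unbalanced[of T n] T homogeneous_form_zero by (force simp: E_def)
  next
    case True
    have fin: "finite T"
      using T finite_subset by blast
    define k where "k = card {k \<in> T. odd k}"
    have cd: "card {i \<in> {..<n} - T. R i} = card {i \<in> {..<n}. R i} - card {i \<in> T. R i}" for R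
    proof -
      have "{i \<in> {..<n} - T. R i} = {i \<in> {..<n}. R i} - {i \<in> T. R i}"
        by auto
      then show ?thesis
        using T fin by (auto intro!: card_Diff_subset)
    qed
    have "k \<le> n div 2"
      unfolding k_def card_parity_lessThan(1)[symmetric] using T by (intro card_mono) auto
    \<comment> \<open>The trailing factor 1 is the form of degree 0 on which the two powers are
      built.\<close>
    define z where "z = (p0 * p1) ^ (n div 2 - k) * ((q0 * q1) ^ k * 1)"
    have "w T = q1 ^ k * q0 ^ k * (p1 ^ (n div 2 - k) * p0 ^ (n div 2 + n mod 2 - k))"
      by (simp only: w_def prod_parity fin finite_Diff finite_lessThan cd card_parity_lessThan
          True[symmetric] k_def[symmetric])
    also have "n div 2 + n mod 2 - k = n mod 2 + (n div 2 - k)"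
      using \<open>k \<le> n div 2\<close> by simp
    finally have "w T = p0 ^ (n mod 2) * z"
      by (simp add: z_def power_add power_mult_distrib mult_ac)
    moreover have "homogeneous_form P Q (n div 2 - k + (k + 0)) z"
      unfolding z_def p q
      by (intro homogeneous_form_linear_power_mult homogeneous_form_one)
    then have "homogeneous_form P Q (n div 2) (of_int (E T) * z)"
      using \<open>k \<le> n div 2\<close> by (intro homogeneous_form_of_int_mult) simp
    ultimately show ?thesis
      by (intro exI[of _ "of_int (E T) * z"]) (simp add: mult_ac)
  qed
  then obtain z where z: "\<And>T. T \<in> Pow {..<n} \<Longrightarrow> homogeneous_form P Q (n div 2) (z T)"
    "\<And>T. T \<in> Pow {..<n} \<Longrightarrow> of_int (E T) * w T = p0 ^ (n mod 2) * z T"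
    by metis
  have "(\<Sum>\<sigma>\<in>signed_perms n. \<Prod>i<n. of_int (step_sign \<sigma> i) * (if odd i then q1 else q0) +
      (if odd i then p1 else p0)) =
    (\<Sum>\<sigma>\<in>signed_perms n. \<Sum>T\<in>Pow {..<n}. of_int (\<Prod>k\<in>T. step_sign \<sigma> k) * w T)"
    by (simp only: prod_add[OF finite_lessThan] prod.distrib w_def of_int_prod mult.assoc)
  also have "\<dots> = (\<Sum>T\<in>Pow {..<n}. of_int (E T) * w T)"
    by (subst sum.swap) (simp add: E_def sum_distrib_right)
  also have "\<dots> = p0 ^ (n mod 2) * (\<Sum>T\<in>Pow {..<n}. z T)"
    by (simp only: z(2) sum_distrib_left cong: sum.cong)
  finally show ?thesis
    using homogeneous_form_sum[of "Pow {..<n}" P Q "n div 2" z] z(1) by blast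
qed

lemma des1_le: "des1 n \<sigma> \<le> n div 2"
  unfolding des1_def card_parity_lessThan(1)[symmetric]
  by (intro card_mono) (auto simp: descents_def)

lemma prod_weights:
  fixes A :: "nat set"
  assumes "finite A"
  shows "(\<Prod>i\<in>A. if i \<in> D then if odd i then a else b else 1) =
    a ^ card {i \<in> A \<inter> D. odd i} * (b :: 'a :: comm_monoid_mult) ^ card {i \<in> A \<inter> D. even i}"
  using assms by (simp add: prod.inter_restrict[symmetric] prod_parity)

text \<open>At an odd position a descent gives \<open>(x - 1) + (1 + x) = 2x\<close> and an ascent
  \<open>-(x - 1) + (1 + x) = 2\<close>; likewise with \<open>y\<close> at even positions. Doubling
  all \<open>n\<close> factors avoids fractions.\<close>

lemma double_weight_des:
  "2 ^ n * (varX ^ des1 n \<sigma> * varY ^ des0 n \<sigma>) =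
    (\<Prod>i<n. of_int (step_sign \<sigma> i) * (if odd i then varX - 1 else varY - 1) +
      (if odd i then 1 + varX else 1 + varY))"
proof -
  have "{..<n} \<inter> descents n \<sigma> = descents n \<sigma>"
    by (auto simp: descents_def)
  then have "2 ^ n * (varX ^ des1 n \<sigma> * varY ^ des0 n \<sigma>) =
    (\<Prod>i<n. 2 * (if i \<in> descents n \<sigma> then if odd i then varX else varY else 1))"
    using prod_weights[of "{..<n}" "descents n \<sigma>" varX varY]
    unfolding prod.distrib by (simp add: des1_def des0_def)
  also have "\<dots> = (\<Prod>i<n. of_int (step_sign \<sigma> i) * (if odd i then varX - 1 else varY - 1) +
      (if odd i then 1 + varX else 1 + varY))"
    by (intro prod.cong) (auto simp: step_sign_def descents_def)
  finally show ?thesis .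
qed

text \<open>Negating the coefficient of the sign at even positions interchanges descents and ascents
  there. Membership in \<open>signed_perms n\<close> ensures that every non-descent is an
  ascent.\<close>

lemma double_weight_asc:
  assumes "\<sigma> \<in> signed_perms n"
  shows "2 ^ n * (varX ^ des1 n \<sigma> * varY ^ asc0 n \<sigma>) =
    (\<Prod>i<n. of_int (step_sign \<sigma> i) * (if odd i then varX - 1 else 1 - varY) +
      (if odd i then 1 + varX else 1 + varY))"
proof -
  define D where "D = {i \<in> descents n \<sigma>. odd i} \<union> {i \<in> ascents n \<sigma>. even i}"
  have D: "{i \<in> {..<n} \<inter> D. odd i} = {i \<in> descents n \<sigma>. odd i}"
    "{i \<in> {..<n} \<inter> D. even i} = {i \<in> ascents n \<sigma>. even i}"
    by (auto simp: D_def descents_def ascents_def)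
  have neq: "\<sigma> (int i) \<noteq> \<sigma> (int (i + 1))" for i
    using injD[OF signed_perms_inj[OF assms], of "int i" "int (i + 1)"] by auto
  have "2 ^ n * (varX ^ des1 n \<sigma> * varY ^ asc0 n \<sigma>) =
    (\<Prod>i<n. 2 * (if i \<in> D then if odd i then varX else varY else 1))"
    using prod_weights[of "{..<n}" D varX varY]
    unfolding prod.distrib D by (simp add: des1_def asc0_def)
  also have "\<dots> = (\<Prod>i<n. of_int (step_sign \<sigma> i) * (if odd i then varX - 1 else 1 - varY) +
      (if odd i then 1 + varX else 1 + varY))"
  proof (intro prod.cong refl)
    fix i assume "i \<in> {..<n}"
    then show "2 * (if i \<in> D then if odd i then varX else varY else 1) =
      of_int (step_sign \<sigma> i) * (if odd i then varX - 1 else 1 - varY) +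
      (if odd i then 1 + varX else 1 + varY)"
      using neq[of i] by (auto simp: step_sign_def D_def descents_def ascents_def)
  qed
  finally show ?thesis .
qed

text \<open>At \<open>y = 0\<close> only the terms with \<open>st \<sigma> = 0\<close> survive, as
  \<open>0 ^ 0 = 1\<close>; the rest is grouping by \<open>des1\<close>.\<close>

lemma poly_sum_at_0:
  "poly (\<Sum>\<sigma>\<in>signed_perms n. varX ^ des1 n \<sigma> * varY ^ st \<sigma>) 0 =
    (\<Sum>j=0..n div 2. of_nat (card {\<sigma> \<in> signed_perms n. des1 n \<sigma> = j \<and> st \<sigma> = 0}) * [:0, 1:] ^ j)"
proof -
  let ?S = "{\<sigma> \<in> signed_perms n. st \<sigma> = 0}"
  have "poly (\<Sum>\<sigma>\<in>signed_perms n. varX ^ des1 n \<sigma> * varY ^ st \<sigma>) 0 =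
      (\<Sum>\<sigma>\<in>signed_perms n. if st \<sigma> = 0 then [:0, 1:] ^ des1 n \<sigma> else 0)"
    unfolding poly_sum by (intro sum.cong) (auto simp: varX_def varY_def)
  also have "\<dots> = (\<Sum>\<sigma>\<in>?S. [:0, 1:] ^ des1 n \<sigma>)"
    by (rule sum.inter_filter[OF finite_signed_perms, symmetric])
  also have "\<dots> = (\<Sum>j=0..n div 2. \<Sum>\<sigma>\<in>{\<sigma> \<in> ?S. des1 n \<sigma> = j}. [:0, 1:] ^ des1 n \<sigma>)"
    using des1_le finite_signed_perms by (intro sum.group[symmetric]) auto
  also have "\<dots> = (\<Sum>j=0..n div 2.
      of_nat (card {\<sigma> \<in> signed_perms n. des1 n \<sigma> = j \<and> st \<sigma> = 0}) * [:0, 1:] ^ j)"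
    by (intro sum.cong refl) (simp add: conj_ac)
  finally show ?thesis .
qed

text \<open>The statistic \<open>st\<close> stands for \<open>des0\<close> or \<open>asc0\<close>.
  At \<open>y = 0\<close> the quantities \<open>1 + varX * varY\<close>, \<open>varX + varY\<close>
  and \<open>1 + varY\<close> become 1, \<open>x\<close> and 1, so the unknown coefficients of the
  form are those of the specialized polynomial, up to \<open>2 ^ n\<close>.\<close>

lemma gamma_expansion:
  fixes q0 :: "int poly poly"
  assumes weight: "\<And>\<sigma>. \<sigma> \<in> signed_perms n \<Longrightarrow> 2 ^ n * (varX ^ des1 n \<sigma> * varY ^ st \<sigma>) =
    (\<Prod>i<n. of_int (step_sign \<sigma> i) * (if odd i then varX - 1 else q0) +
      (if odd i then 1 + varX else 1 + varY))"
    and q: "q0 * (varX - 1) = of_int c * (1 + varX * varY) + of_int d * (varX + varY)"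
  shows "(\<Sum>\<sigma>\<in>signed_perms n. varX ^ des1 n \<sigma> * varY ^ st \<sigma>) = (1 + varY) ^ (n mod 2) *
    (\<Sum>j=0..n div 2. of_nat (card {\<sigma> \<in> signed_perms n. des1 n \<sigma> = j \<and> st \<sigma> = 0}) *
      (varX + varY) ^ j * (1 + varX * varY) ^ (n div 2 - j))"
proof -
  define F where "F = (\<Sum>\<sigma>\<in>signed_perms n. varX ^ des1 n \<sigma> * varY ^ st \<sigma>)"
  define b where "b j = card {\<sigma> \<in> signed_perms n. des1 n \<sigma> = j \<and> st \<sigma> = 0}" for j
  have p: "(1 + varY) * (1 + varX) = of_int 1 * (1 + varX * varY) + of_int 1 * (varX + varY)"
    by (simp add: algebra_simps)
  obtain z where z: "homogeneous_form (1 + varX * varY) (varX + varY) (n div 2) z"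
    and "(\<Sum>\<sigma>\<in>signed_perms n. \<Prod>i<n. of_int (step_sign \<sigma> i) * (if odd i then varX - 1 else q0) +
      (if odd i then 1 + varX else 1 + varY)) = (1 + varY) ^ (n mod 2) * z"
    using sum_prod_signs_homogeneous[OF p q, of n] by blast
  then have F: "2 ^ n * F = (1 + varY) ^ (n mod 2) * z"
    by (simp add: F_def sum_distrib_left weight)
  from z obtain e :: "nat \<Rightarrow> int" where
    e: "z = (\<Sum>j\<le>n div 2. of_int (e j) * (varX + varY) ^ j * (1 + varX * varY) ^ (n div 2 - j))"
    by (auto simp: homogeneous_form_def)
  have "2 ^ n * poly F 0 = poly (2 ^ n * F) 0"
    by simp
  also have "\<dots> = (\<Sum>j\<le>n div 2. of_int (e j) * [:0, 1:] ^ j)"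
    unfolding F e by (simp add: poly_sum varX_def varY_def)
  finally have eq: "2 ^ n * (\<Sum>j\<le>n div 2. of_nat (b j) * [:0, 1:] ^ j) =
    (\<Sum>j\<le>n div 2. of_int (e j) * [:0, 1:: int:] ^ j)"
    unfolding F_def poly_sum_at_0 b_def atLeast0AtMost by simp
  \<comment> \<open>Powers of \<open>x\<close> are distinct monomials, so equal sums have equal
    coefficients.\<close>
  have coeff: "coeff (\<Sum>j\<le>m. of_int (f j) * [:0, 1 :: int:] ^ j) k = (if k \<le> m then f k else 0)"
    for m k and f :: "nat \<Rightarrow> int"
    by (simp add: coeff_sum of_int_poly monom_altdef[symmetric, of 1, simplified]
      if_distrib sum.delta cong: if_cong)
  have "e j = 2 ^ n * int (b j)" if "j \<le> n div 2" for j
  proof -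
    have "2 ^ n * (\<Sum>j\<le>n div 2. of_nat (b j) * [:0, 1 :: int:] ^ j) =
      (\<Sum>j\<le>n div 2. of_int (2 ^ n * int (b j)) * [:0, 1:] ^ j)"
      by (simp add: sum_distrib_left mult.assoc)
    then show ?thesis
      using arg_cong[OF eq, of "\<lambda>p. coeff p j"] that by (simp only: coeff if_True)
  qed
  then have "z = 2 ^ n * (\<Sum>j=0..n div 2. of_nat (b j) * (varX + varY) ^ j *
      (1 + varX * varY) ^ (n div 2 - j))"
    unfolding e atLeast0AtMost sum_distrib_left by (intro sum.cong) (auto simp: mult.assoc)
  with F have "2 ^ n * F = 2 ^ n * ((1 + varY) ^ (n mod 2) * (\<Sum>j=0..n div 2. of_nat (b j) *
      (varX + varY) ^ j * (1 + varX * varY) ^ (n div 2 - j)))"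
    by (simp only: mult.left_commute)
  then have "F = (1 + varY) ^ (n mod 2) * (\<Sum>j=0..n div 2. of_nat (b j) *
      (varX + varY) ^ j * (1 + varX * varY) ^ (n div 2 - j))"
    \<comment> \<open>\<open>int poly poly\<close> is an integral domain in which
      \<open>2 ^ n\<close> is nonzero.\<close>
    by (subst (asm) mult_left_cancel) auto
  then show ?thesis
    by (simp only: F_def b_def)
qed

lemma B_poly_expansion:
  "B_poly n = (1 + varY) ^ (n mod 2) * (\<Sum>j=0..n div 2.
    of_nat (b_num n j) * (varX + varY) ^ j * (1 + varX * varY) ^ (n div 2 - j))"
  unfolding B_poly_def b_num_def
  \<comment> \<open>The constants come from
    \<open>(y - 1)(x - 1) = (1 + xy) - (x + y)\<close>.\<close>
  by (rule gamma_expansion[where c = 1 and d = "-1", OF double_weight_des])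
    (simp add: algebra_simps)

lemma Bhat_poly_expansion:
  "Bhat_poly n = (1 + varY) ^ (n mod 2) * (\<Sum>j=0..n div 2.
    of_nat (bbar_num n j) * (varX + varY) ^ j * (1 + varX * varY) ^ (n div 2 - j))"
  unfolding Bhat_poly_def bbar_num_def
  \<comment> \<open>Here \<open>(1 - y)(x - 1) = -(1 + xy) + (x + y)\<close>.\<close>
  by (rule gamma_expansion[where c = "-1" and d = 1, OF double_weight_asc])
    (simp_all add: algebra_simps)

text \<open>For even \<open>n\<close> the power is 1; for odd \<open>n\<close> it is
  \<open>1 + varY\<close>, which is nonzero and so cancels in the fraction field.\<close>

lemma fract_cancel_one_plus_varY:
  assumes "p = (1 + varY) ^ (n mod 2) * q"
  shows "(if even n then to_fract p else inverse (to_fract (1 + varY)) * to_fract p) = to_fract q"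
proof -
  have "1 + varY \<noteq> 0"
    by (simp add: varY_def one_pCons)
  then have "to_fract (1 + varY) \<noteq> 0"
    by (simp only: to_fract_eq_0_iff not_False_eq_True)
  then show ?thesis
    by (cases "even n")
      (simp_all add: assms even_iff_mod_2_eq_zero odd_iff_mod_2_eq_one mult.assoc[symmetric]
        del: to_fract_add)
qed

theorem theorem2p10:
  fixes n :: nat
  assumes "n \<ge> 1"
  shows "poly (B_poly n) 0 = (\<Sum>j=0..n div 2. of_nat (b_num n j) * [:0, 1:] ^ j) \<and>
         poly (Bhat_poly n) 0 = (\<Sum>j=0..n div 2. of_nat (bbar_num n j) * [:0, 1:] ^ j) \<and>
         Btilde n = to_fract (\<Sum>j=0..n div 2.
           of_nat (b_num n j) * (varX + varY) ^ j * (1 + varX * varY) ^ (n div 2 - j)) \<and>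
         Bbar n = to_fract (\<Sum>j=0..n div 2.
           of_nat (bbar_num n j) * (varX + varY) ^ j * (1 + varX * varY) ^ (n div 2 - j))"
  using poly_sum_at_0[of n "des0 n"] poly_sum_at_0[of n "asc0 n"]
    fract_cancel_one_plus_varY[OF B_poly_expansion]
    fract_cancel_one_plus_varY[OF Bhat_poly_expansion]
  unfolding B_poly_def Bhat_poly_def b_num_def bbar_num_def Btilde_def Bbar_def
  by (intro conjI)

end
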